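(* Let $\mathsf C$ be a concrete category with products. A morphism $$((\varphi,\Phi),f):\Big(\{\mathcal D_{X,x}\}_{x\in X},\ \iota_X:a\to\prod_{x\in X}\mathcal D_{X,x}\Big)\to\Big(\{\mathcal D_{Y,y}\}_{y\in Y},\ \iota_Y:b\to\prod_{y\in Y}\mathcal D_{Y,y}\Big)$$ of networks of discrete-time open systems in $\mathsf C$ induces a 1-morphism $$\begin{array}{ccc}\prod_{y\in Y}\Gamma_\tau(\mathcal D_{Y,y})&\xrightarrow{\ \Gamma_\tau(\varphi,\Phi)\ }&\prod_{x\in X}\Gamma_\tau(\mathcal D_{X,x})\\ {\scriptstyle\Gamma_\tau(\iota_Y)\circ\mathscr P_Y}\downarrow&\Downarrow&\downarrow{\scriptstyle\Gamma_\tau(\iota_X)\circ\mathscr P_X}\\ \Gamma_\tau(b)&\xrightarrow{\ \Gamma_\tau(f)\ }&\Gamma_\tau(a)\end{array}$$ in $\mathsf{Set}^\square$ (horizontal arrows are relations, vertical arrows are functions), where $\Gamma_\tau(\varphi,\Phi)$ is the set of pairs $\big((w_y)_{y\in Y},(v_x)_{x\in X}\big)$ with $(w_{\varphi(x)},v_x)\in\Gamma_\tau(\Phi_x)$ for all $x\in X$.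
   Context: Let $\mathcal U=\mathrm{id}_{\mathsf C}$, $\mathcal T c=c\times c$, and $\tau_c:c\times c\to c$ the projection to the first factor. $\mathsf A$ is the full subcategory of the arrow category $\mathrm{Arrow}(\mathsf C)$ whose objects are the morphisms $a=(p_a:a_{tot}\to a_{st})$ of $\mathsf C$ that are surjective on underlying sets; a morphism $f:a\to b$ in $\mathsf A$ is a pair $(f_{tot},f_{st})$ with $p_b\circ f_{tot}=f_{st}\circ p_a$. Products are taken componentwise on $tot$ and $st$, and all products appearing are objects of $\mathsf A$. $\Gamma_\tau(a)=\{v:a_{tot}\to a_{st}\times a_{st}\text{ in }\mathsf C:\ \tau_{a_{st}}\circ v=p_a\}$; such a $v$ (a discrete-time open system) amounts to an arbitrary morphism $a_{tot}\to a_{st}$ (the second component). For $f:a\to b$, $\Gamma_\tau(f)\subseteq\Gamma_\tau(a)\times\Gamma_\tau(b)$ is the relation of $f$-related pairs $(v,w)$: $(f_{st}\times f_{st})\circ v=w\circ f_{tot}$. A morphism $i:a\to b$ in $\mathsf A$ is an interconnection if $i_{st}$ is an isomorphism; then $\Gamma_\tau(i)$ also denotes the function $\Gamma_\tau(b)\to\Gamma_\tau(a)$, $w\mapsto(i_{st}\times i_{st})^{-1}\circ w\circ i_{tot}$ (used for the vertical arrows). $\mathscr P_X:\prod_{x\in X}\Gamma_\tau(a_x)\to\Gamma_\tau(\prod_{x\in X} a_x)$ sends $(v_x)_x$ to $\prod_x v_x:\prod_x a_{x,tot}\to\prod_x(a_{x,st}\times a_{x,st})\cong(\prod_x a_{x,st})\times(\prod_x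 a_{x,st})$. A network of discrete-time open systems is a pair $(\{\mathcal D_{X,x}\}_{x\in X},\iota_X:a\to\prod_x\mathcal D_{X,x})$ with $X$ a finite set, $\mathcal D_{X,x}\in\mathsf A$, and $\iota_X$ an interconnection. A morphism $((\varphi,\Phi),f)$ from $(\mathcal D_X,\iota_X:a\to\prod_x\mathcal D_{X,x})$ to $(\mathcal D_Y,\iota_Y:b\to\prod_y\mathcal D_{Y,y})$ consists of a map of sets $\varphi:X\to Y$, morphisms $\Phi_x:\mathcal D_{Y,\varphi(x)}\to\mathcal D_{X,x}$ in $\mathsf A$, and $f:b\to a$ in $\mathsf A$ with $\iota_X\circ f=\Pi(\varphi,\Phi)\circ\iota_Y$, where $\Pi(\varphi,\Phi):\prod_y\mathcal D_{Y,y}\to\prod_x\mathcal D_{X,x}$ is the unique morphism with $\mathrm{pr}_x\circ\Pi(\varphi,\Phi)=\Phi_x\circ\mathrm{pr}_{\varphi(x)}$. $\mathsf{Set}^\square$ is the double category of sets, with functions as vertical arrows and relations as horizontal arrows; a 1-morphism from $R\subseteq A\times B$ to $R'\subseteq A'\times B'$ along functions $g:A\to A'$, $h:B\to B'$ is the inclusion $(g\times h)(R)\subseteq R'$. *)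

theory Defs
  imports Main "HOL-Library.FuncSet"
begin

record ('o, 'm) category =
  obj :: "'o set"
  arr :: "'m set"
  src :: "'m \<Rightarrow> 'o"
  tgt :: "'m \<Rightarrow> 'o"
  ide :: "'o \<Rightarrow> 'm"
  cmp :: "'m \<Rightarrow> 'm \<Rightarrow> 'm"  (infixr "\<cdot>\<index>" 70)

definition hom :: "('o, 'm, 'e) category_scheme \<Rightarrow> 'o \<Rightarrow> 'o \<Rightarrow> 'm set" where
  "hom C a b = {f \<in> arr C. src C f = a \<and> tgt C f = b}"

locale category =
  fixes C :: "('o, 'm, 'e) category_scheme"  (structure)
  assumes src_obj: "f \<in> arr C \<Longrightarrow> src C f \<in> obj C"
    and tgt_obj: "f \<in> arr C \<Longrightarrow> tgt C f \<in> obj C"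
    and ide_hom: "a \<in> obj C \<Longrightarrow> ide C a \<in> hom C a a"
    and cmp_hom: "\<lbrakk>f \<in> hom C a b; g \<in> hom C b c\<rbrakk> \<Longrightarrow> g \<cdot> f \<in> hom C a c"
    and cmp_ide_left: "f \<in> hom C a b \<Longrightarrow> ide C b \<cdot> f = f"
    and cmp_ide_right: "f \<in> hom C a b \<Longrightarrow> f \<cdot> ide C a = f"
    and cmp_assoc: "\<lbrakk>f \<in> hom C a b; g \<in> hom C b c; h \<in> hom C c d\<rbrakk>
          \<Longrightarrow> (h \<cdot> g) \<cdot> f = h \<cdot> (g \<cdot> f)"

definition inverse_arrows :: "('o, 'm, 'e) category_scheme \<Rightarrow> 'm \<Rightarrow> 'm \<Rightarrow> bool" where
  "inverse_arrows C f g \<longleftrightarrow>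
     f \<in> arr C \<and> g \<in> hom C (tgt C f) (src C f) \<and>
     g \<cdot>\<^bsub>C\<^esub> f = ide C (src C f) \<and> f \<cdot>\<^bsub>C\<^esub> g = ide C (tgt C f)"

definition iso_arrow :: "('o, 'm, 'e) category_scheme \<Rightarrow> 'm \<Rightarrow> bool" where
  "iso_arrow C f \<longleftrightarrow> (\<exists>g. inverse_arrows C f g)"

definition inv_arrow :: "('o, 'm, 'e) category_scheme \<Rightarrow> 'm \<Rightarrow> 'm" where
  "inv_arrow C f = (THE g. inverse_arrows C f g)"

definition full_subcategory ::
  "('o, 'm) category \<Rightarrow> 'o set \<Rightarrow> ('o, 'm) category" where
  "full_subcategory C S =
     C\<lparr>obj := obj C \<inter> S, arr := {f \<in> arr C. src C f \<in> S \<and> tgt C f \<in> S}\<rparr>"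

definition is_product ::
  "('o, 'm, 'e) category_scheme \<Rightarrow> 'i set \<Rightarrow> ('i \<Rightarrow> 'o) \<Rightarrow> 'o \<Rightarrow> ('i \<Rightarrow> 'm) \<Rightarrow> bool" where
  "is_product C I F P pr \<longleftrightarrow>
     P \<in> obj C \<and> (\<forall>i\<in>I. pr i \<in> hom C P (F i)) \<and>
     (\<forall>c\<in>obj C. \<forall>g. (\<forall>i\<in>I. g i \<in> hom C c (F i)) \<longrightarrow>
        (\<exists>!h. h \<in> hom C c P \<and> (\<forall>i\<in>I. pr i \<cdot>\<^bsub>C\<^esub> h = g i)))"

definition mediating ::
  "('o, 'm, 'e) category_scheme \<Rightarrow> 'i set \<Rightarrow> 'o \<Rightarrow> ('i \<Rightarrow> 'm) \<Rightarrow> 'o \<Rightarrow> ('i \<Rightarrow> 'm) \<Rightarrow> 'm" where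
  "mediating C I P pr c g =
     (THE h. h \<in> hom C c P \<and> (\<forall>i\<in>I. pr i \<cdot>\<^bsub>C\<^esub> h = g i))"

text \<open>A concrete category is given by its faithful underlying-set functor
  (\<open>und\<close>, \<open>ufun\<close>); the function \<open>ufun f\<close> is only meaningful on \<open>und (src f)\<close>.
  Products are an arbitrary choice of product cones: for every finite family indexed by a subset
  of \<open>'i\<close>, and for every pair of objects. The underlying-set functor
  is not assumed to preserve products. A family indexed by \<open>I\<close> is an element of
  \<open>I \<rightarrow>\<^sub>E obj C\<close>, so that the chosen product does not depend on values outside \<open>I\<close>;
  \<open>Prod\<close> and \<open>Proj\<close> restrict an arbitrary function to \<open>I\<close> first.\<close>

record ('o, 'm, 'u, 'i) concrete_category = "('o, 'm) category" +
  und :: "'o \<Rightarrow> 'u set"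
  ufun :: "'m \<Rightarrow> 'u \<Rightarrow> 'u"
  prod_obj :: "'i set \<Rightarrow> ('i \<Rightarrow> 'o) \<Rightarrow> 'o"
  proj :: "'i set \<Rightarrow> ('i \<Rightarrow> 'o) \<Rightarrow> 'i \<Rightarrow> 'm"
  bprod :: "'o \<Rightarrow> 'o \<Rightarrow> 'o"
  bfst :: "'o \<Rightarrow> 'o \<Rightarrow> 'm"
  bsnd :: "'o \<Rightarrow> 'o \<Rightarrow> 'm"

locale concrete_category = category C
  for C :: "('o, 'm, 'u, 'i, 'e) concrete_category_scheme"  (structure) +
  assumes ufun_funcset: "f \<in> hom C a b \<Longrightarrow> ufun C f \<in> und C a \<rightarrow> und C b"
    and ufun_ide: "\<lbrakk>a \<in> obj C; u \<in> und C a\<rbrakk> \<Longrightarrow> ufun C (ide C a) u = u"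
    and ufun_cmp: "\<lbrakk>f \<in> hom C a b; g \<in> hom C b c; u \<in> und C a\<rbrakk>
          \<Longrightarrow> ufun C (g \<cdot> f) u = ufun C g (ufun C f u)"
    and faithful: "\<lbrakk>f \<in> hom C a b; g \<in> hom C a b; \<And>u. u \<in> und C a \<Longrightarrow> ufun C f u = ufun C g u\<rbrakk>
          \<Longrightarrow> f = g"

locale concrete_category_with_products = concrete_category C
  for C :: "('o, 'm, 'u, 'i, 'e) concrete_category_scheme"  (structure) +
  assumes finite_product:
      "\<lbrakk>finite I; F \<in> I \<rightarrow>\<^sub>E obj C\<rbrakk> \<Longrightarrow> is_product C I F (prod_obj C I F) (proj C I F)"
    and binary_product:
      "\<lbrakk>c \<in> obj C; d \<in> obj C\<rbrakk> \<Longrightarrow>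
         is_product C UNIV (case_bool c d) (bprod C c d) (case_bool (bfst C c d) (bsnd C c d))"

definition Prod ::
  "('o, 'm, 'u, 'i, 'e) concrete_category_scheme \<Rightarrow> 'i set \<Rightarrow> ('i \<Rightarrow> 'o) \<Rightarrow> 'o" where
  "Prod C I F = prod_obj C I (restrict F I)"

definition Proj ::
  "('o, 'm, 'u, 'i, 'e) concrete_category_scheme \<Rightarrow> 'i set \<Rightarrow> ('i \<Rightarrow> 'o) \<Rightarrow> 'i \<Rightarrow> 'm" where
  "Proj C I F = proj C I (restrict F I)"

definition prod_arr ::
  "('o, 'm, 'u, 'i, 'e) concrete_category_scheme \<Rightarrow> 'i set \<Rightarrow> ('i \<Rightarrow> 'm) \<Rightarrow> 'm" where
  "prod_arr C I f =
     mediating C I (Prod C I (\<lambda>i. tgt C (f i))) (Proj C I (\<lambda>i. tgt C (f i)))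
       (Prod C I (\<lambda>i. src C (f i)))
       (\<lambda>i. f i \<cdot>\<^bsub>C\<^esub> Proj C I (\<lambda>i. src C (f i)) i)"

definition pair_arr ::
  "('o, 'm, 'u, 'i, 'e) concrete_category_scheme \<Rightarrow> 'm \<Rightarrow> 'm \<Rightarrow> 'm" where
  "pair_arr C f g =
     mediating C UNIV (bprod C (tgt C f) (tgt C g))
       (case_bool (bfst C (tgt C f) (tgt C g)) (bsnd C (tgt C f) (tgt C g)))
       (src C f) (case_bool f g)"

definition T_obj :: "('o, 'm, 'u, 'i, 'e) concrete_category_scheme \<Rightarrow> 'o \<Rightarrow> 'o" where
  "T_obj C c = bprod C c c"

definition T_arr :: "('o, 'm, 'u, 'i, 'e) concrete_category_scheme \<Rightarrow> 'm \<Rightarrow> 'm" where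
  "T_arr C f =
     pair_arr C (f \<cdot>\<^bsub>C\<^esub> bfst C (src C f) (src C f)) (f \<cdot>\<^bsub>C\<^esub> bsnd C (src C f) (src C f))"

definition tau :: "('o, 'm, 'u, 'i, 'e) concrete_category_scheme \<Rightarrow> 'o \<Rightarrow> 'm" where
  "tau C c = bfst C c c"

text \<open>An object of the arrow category is an arrow \<open>a\<close> of \<open>C\<close>, with
  \<open>a\<^sub>t\<^sub>o\<^sub>t = src C a\<close>, \<open>a\<^sub>s\<^sub>t = tgt C a\<close> and \<open>p\<^sub>a = a\<close>.\<close>

record 'm arrow_mor =
  dom_ob :: 'm
  cod_ob :: 'm
  tot :: 'm
  st :: 'm

definition arrow_category ::
  "('o, 'm, 'e) category_scheme \<Rightarrow> ('m, 'm arrow_mor) category" where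
  "arrow_category C =
     \<lparr>obj = arr C,
      arr = {f. dom_ob f \<in> arr C \<and> cod_ob f \<in> arr C \<and>
                tot f \<in> hom C (src C (dom_ob f)) (src C (cod_ob f)) \<and>
                st f \<in> hom C (tgt C (dom_ob f)) (tgt C (cod_ob f)) \<and>
                cod_ob f \<cdot>\<^bsub>C\<^esub> tot f = st f \<cdot>\<^bsub>C\<^esub> dom_ob f},
      src = dom_ob,
      tgt = cod_ob,
      ide = (\<lambda>a. \<lparr>dom_ob = a, cod_ob = a, tot = ide C (src C a), st = ide C (tgt C a)\<rparr>),
      cmp = (\<lambda>g f. \<lparr>dom_ob = dom_ob f, cod_ob = cod_ob g,
                     tot = tot g \<cdot>\<^bsub>C\<^esub> tot f, st = st g \<cdot>\<^bsub>C\<^esub> st f\<rparr>)\<rparr>"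

definition surj_arrows ::
  "('o, 'm, 'u, 'i, 'e) concrete_category_scheme \<Rightarrow> ('m, 'm arrow_mor) category" where
  "surj_arrows C =
     full_subcategory (arrow_category C)
       {p \<in> arr C. ufun C p ` und C (src C p) = und C (tgt C p)}"

definition A_proj ::
  "('o, 'm, 'u, 'i, 'e) concrete_category_scheme \<Rightarrow> 'i set \<Rightarrow> ('i \<Rightarrow> 'm) \<Rightarrow> 'i \<Rightarrow> 'm arrow_mor" where
  "A_proj C I D i =
     \<lparr>dom_ob = prod_arr C I D, cod_ob = D i,
      tot = Proj C I (\<lambda>i. src C (D i)) i, st = Proj C I (\<lambda>i. tgt C (D i)) i\<rparr>"

definition Gam :: "('o, 'm, 'u, 'i, 'e) concrete_category_scheme \<Rightarrow> 'm \<Rightarrow> 'm set" where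
  "Gam C a = {v \<in> hom C (src C a) (T_obj C (tgt C a)). tau C (tgt C a) \<cdot>\<^bsub>C\<^esub> v = a}"

definition Gam_rel ::
  "('o, 'm, 'u, 'i, 'e) concrete_category_scheme \<Rightarrow> 'm arrow_mor \<Rightarrow> ('m \<times> 'm) set" where
  "Gam_rel C f =
     {(v, w) \<in> Gam C (dom_ob f) \<times> Gam C (cod_ob f). T_arr C (st f) \<cdot>\<^bsub>C\<^esub> v = w \<cdot>\<^bsub>C\<^esub> tot f}"

definition interconnection ::
  "('o, 'm, 'u, 'i, 'e) concrete_category_scheme \<Rightarrow> 'm arrow_mor \<Rightarrow> bool" where
  "interconnection C i \<longleftrightarrow> i \<in> arr (surj_arrows C) \<and> iso_arrow C (st i)"

definition Gam_fun ::
  "('o, 'm, 'u, 'i, 'e) concrete_category_scheme \<Rightarrow> 'm arrow_mor \<Rightarrow> 'm \<Rightarrow> 'm" where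
  "Gam_fun C i w = inv_arrow C (T_arr C (st i)) \<cdot>\<^bsub>C\<^esub> w \<cdot>\<^bsub>C\<^esub> tot i"

text \<open>\<open>T_prod_iso C I F\<close> is the canonical isomorphism from the product of the \<open>F i \<times> F i\<close> to
  the square of the product of the \<open>F i\<close>.\<close>

definition T_prod_iso ::
  "('o, 'm, 'u, 'i, 'e) concrete_category_scheme \<Rightarrow> 'i set \<Rightarrow> ('i \<Rightarrow> 'o) \<Rightarrow> 'm" where
  "T_prod_iso C I F =
     pair_arr C (prod_arr C I (\<lambda>i. bfst C (F i) (F i))) (prod_arr C I (\<lambda>i. bsnd C (F i) (F i)))"

definition P_map ::
  "('o, 'm, 'u, 'i, 'e) concrete_category_scheme \<Rightarrow> 'i set \<Rightarrow> ('i \<Rightarrow> 'm) \<Rightarrow> ('i \<Rightarrow> 'm) \<Rightarrow> 'm" where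
  "P_map C I D v = T_prod_iso C I (\<lambda>i. tgt C (D i)) \<cdot>\<^bsub>C\<^esub> prod_arr C I v"

record ('i, 'm) network =
  nodes :: "'i set"
  sys :: "'i \<Rightarrow> 'm"
  inter :: "'m arrow_mor"

text \<open>As \<open>surj_arrows C\<close> is a full subcategory, membership of \<open>inter N\<close> in the hom-set
  entails that the componentwise product of the systems is itself an object of it.\<close>

definition is_network ::
  "('o, 'm, 'u, 'i, 'e) concrete_category_scheme \<Rightarrow> ('i, 'm) network \<Rightarrow> bool" where
  "is_network C N \<longleftrightarrow>
     finite (nodes N) \<and> sys N \<in> nodes N \<rightarrow> obj (surj_arrows C) \<and>
     inter N \<in> hom (surj_arrows C) (dom_ob (inter N)) (prod_arr C (nodes N) (sys N)) \<and>
     interconnection C (inter N)"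

definition Pi_map ::
  "('o, 'm, 'u, 'i, 'e) concrete_category_scheme \<Rightarrow> ('i, 'm) network \<Rightarrow> ('i, 'm) network
     \<Rightarrow> ('i \<Rightarrow> 'i) \<Rightarrow> ('i \<Rightarrow> 'm arrow_mor) \<Rightarrow> 'm arrow_mor" where
  "Pi_map C M N \<phi> \<Phi> =
     mediating (surj_arrows C) (nodes M)
       (prod_arr C (nodes M) (sys M)) (A_proj C (nodes M) (sys M))
       (prod_arr C (nodes N) (sys N))
       (\<lambda>x. \<Phi> x \<cdot>\<^bsub>surj_arrows C\<^esub> A_proj C (nodes N) (sys N) (\<phi> x))"

definition is_network_morphism ::
  "('o, 'm, 'u, 'i, 'e) concrete_category_scheme \<Rightarrow> ('i, 'm) network \<Rightarrow> ('i, 'm) network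
     \<Rightarrow> ('i \<Rightarrow> 'i) \<Rightarrow> ('i \<Rightarrow> 'm arrow_mor) \<Rightarrow> 'm arrow_mor \<Rightarrow> bool" where
  "is_network_morphism C M N \<phi> \<Phi> f \<longleftrightarrow>
     \<phi> \<in> nodes M \<rightarrow> nodes N \<and>
     (\<forall>x\<in>nodes M. \<Phi> x \<in> hom (surj_arrows C) (sys N (\<phi> x)) (sys M x)) \<and>
     f \<in> hom (surj_arrows C) (dom_ob (inter N)) (dom_ob (inter M)) \<and>
     inter M \<cdot>\<^bsub>surj_arrows C\<^esub> f = Pi_map C M N \<phi> \<Phi> \<cdot>\<^bsub>surj_arrows C\<^esub> inter N"

definition Gam_prod ::
  "('o, 'm, 'u, 'i, 'e) concrete_category_scheme \<Rightarrow> ('i, 'm) network \<Rightarrow> ('i \<Rightarrow> 'm) set" where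
  "Gam_prod C N = (\<Pi>\<^sub>E x\<in>nodes N. Gam C (sys N x))"

definition Gam_prod_rel ::
  "('o, 'm, 'u, 'i, 'e) concrete_category_scheme \<Rightarrow> ('i, 'm) network \<Rightarrow> ('i, 'm) network
     \<Rightarrow> ('i \<Rightarrow> 'i) \<Rightarrow> ('i \<Rightarrow> 'm arrow_mor) \<Rightarrow> (('i \<Rightarrow> 'm) \<times> ('i \<Rightarrow> 'm)) set" where
  "Gam_prod_rel C M N \<phi> \<Phi> =
     {(w, v) \<in> Gam_prod C N \<times> Gam_prod C M. \<forall>x\<in>nodes M. (w (\<phi> x), v x) \<in> Gam_rel C (\<Phi> x)}"

text \<open>The 1-morphisms of the double category of sets, from the horizontal arrow \<open>R\<close>
  between \<open>A\<close> and \<open>B\<close> to \<open>R'\<close> between \<open>A'\<close> and \<open>B'\<close>, along the vertical arrows \<open>g\<close> and \<open>h\<close>;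
  these are functions on \<open>A\<close> and \<open>B\<close>, so their values elsewhere are irrelevant.\<close>

definition set_square ::
  "'a set \<Rightarrow> 'b set \<Rightarrow> 'c set \<Rightarrow> 'd set \<Rightarrow> ('a \<times> 'b) set \<Rightarrow> ('c \<times> 'd) set
     \<Rightarrow> ('a \<Rightarrow> 'c) \<Rightarrow> ('b \<Rightarrow> 'd) \<Rightarrow> bool" where
  "set_square A B A' B' R R' g h \<longleftrightarrow>
     R \<subseteq> A \<times> B \<and> R' \<subseteq> A' \<times> B' \<and> g \<in> A \<rightarrow> A' \<and> h \<in> B \<rightarrow> B' \<and>
     map_prod g h ` R \<subseteq> R'"

end

theory Submission
  imports Defs
begin

text \<open>A morphism into a square \<open>T_obj C c\<close> is determined by its two projections, and a morphism
  into a product by its components. Hence the square reduces to the identity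
  \<open>T(\<Pi>\<^sub>s\<^sub>t) \<circ> P(w) = P(v) \<circ> \<Pi>\<^sub>t\<^sub>o\<^sub>t\<close>, where \<open>\<Pi>\<close> is the map of products induced by \<open>\<Phi>\<close>, and this can be
  checked at each node \<open>x\<close>, where it is the assumption that \<open>w (\<phi> x)\<close> and \<open>v x\<close> are
  \<open>\<Phi> x\<close>-related. Precomposing with the interconnection of \<open>N\<close> and cancelling the isomorphism
  \<open>T\<close> of the state part of the interconnection of \<open>M\<close> gives the claim.\<close>

section \<open>Mediating morphisms of product cones\<close>

lemma homD:
  assumes "f \<in> hom C a b"
  shows "f \<in> arr C" "src C f = a" "tgt C f = b"
  using assms by (auto simp: hom_def)

text \<open>The universal property supplies the unique existence that makes the \<open>THE\<close>
  in \<open>mediating\<close> meaningful. It is kept at the level of an arbitrary \<open>C\<close>,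
  so that it serves both the base category and \<open>surj_arrows C\<close>.\<close>

lemma mediating_props:
  assumes "is_product C I F P pr" "c \<in> obj C" "\<forall>i\<in>I. g i \<in> hom C c (F i)"
  shows mediating_hom: "mediating C I P pr c g \<in> hom C c P"
    and proj_mediating: "i \<in> I \<Longrightarrow> pr i \<cdot>\<^bsub>C\<^esub> mediating C I P pr c g = g i"
proof -
  have "\<exists>!h. h \<in> hom C c P \<and> (\<forall>i\<in>I. pr i \<cdot>\<^bsub>C\<^esub> h = g i)"
    using assms unfolding is_product_def by blast
  from theI'[OF this]
  show "mediating C I P pr c g \<in> hom C c P"
    and "i \<in> I \<Longrightarrow> pr i \<cdot>\<^bsub>C\<^esub> mediating C I P pr c g = g i"
    by (auto simp: mediating_def)
qed

section \<open>Uniqueness into products, and inverses\<close>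

context category
begin

lemma hom_obj:
  assumes "f \<in> hom C a b"
  shows "a \<in> obj C" "b \<in> obj C"
  using assms src_obj tgt_obj by (auto simp: hom_def)

lemma product_ext:
  assumes P: "is_product C I F P pr" and h: "h \<in> hom C c P" and k: "k \<in> hom C c P"
    and eq: "\<And>i. i \<in> I \<Longrightarrow> pr i \<cdot> h = pr i \<cdot> k"
  shows "h = k"
proof -
  \<comment> \<open>The universal property is instantiated at the cone with legs
    \<open>pr i \<cdot> k\<close>; by \<open>eq\<close>, the morphism \<open>h\<close> induces the
    same cone.\<close>
  have "\<forall>i\<in>I. pr i \<cdot> k \<in> hom C c (F i)"
    using P cmp_hom[OF k] by (simp add: is_product_def)
  moreover have "\<forall>g. (\<forall>i\<in>I. g i \<in> hom C c (F i)) \<longrightarrow>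
      (\<exists>!h. h \<in> hom C c P \<and> (\<forall>i\<in>I. pr i \<cdot> h = g i))"
    using P hom_obj(1)[OF k] by (simp add: is_product_def)
  ultimately have "\<exists>!h. h \<in> hom C c P \<and> (\<forall>i\<in>I. pr i \<cdot> h = pr i \<cdot> k)"
    by (elim allE[of _ "\<lambda>i. pr i \<cdot> k"] mp)
  then show ?thesis
    using h k eq by blast
qed

lemma inverse_arrows_unique:
  assumes g: "inverse_arrows C f g" and h: "inverse_arrows C f h"
  shows "g = h"
proof -
  have f: "f \<in> hom C (src C f) (tgt C f)"
    and gh: "g \<in> hom C (tgt C f) (src C f)" "h \<in> hom C (tgt C f) (src C f)"
    using g h by (auto simp: inverse_arrows_def hom_def)
  have "g = (g \<cdot> f) \<cdot> h"
    using g h cmp_assoc[OF gh(2) f gh(1)] cmp_ide_right[OF gh(1)] by (simp add: inverse_arrows_def)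
  also have "\<dots> = h"
    using g cmp_ide_left[OF gh(2)] by (simp add: inverse_arrows_def)
  finally show ?thesis .
qed

lemma inv_arrow_eq: "inverse_arrows C f g \<Longrightarrow> inv_arrow C f = g"
  unfolding inv_arrow_def by (blast intro: the_equality inverse_arrows_unique)

lemma inv_arrow:
  assumes "f \<in> hom C a b" "iso_arrow C f"
  shows inv_arrow_hom: "inv_arrow C f \<in> hom C b a"
    and inv_arrow_left: "inv_arrow C f \<cdot> f = ide C a"
    and inv_arrow_right: "f \<cdot> inv_arrow C f = ide C b"
proof -
  obtain g where "inverse_arrows C f g"
    using assms(2) by (auto simp: iso_arrow_def)
  then show "inv_arrow C f \<in> hom C b a" "inv_arrow C f \<cdot> f = ide C a"
    "f \<cdot> inv_arrow C f = ide C b"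
    using assms(1) inv_arrow_eq by (auto simp: inverse_arrows_def hom_def)
qed

lemma iso_cancel_left:
  assumes f: "f \<in> hom C a b" "iso_arrow C f" and h: "h \<in> hom C c a" "k \<in> hom C c a"
    and eq: "f \<cdot> h = f \<cdot> k"
  shows "h = k"
proof -
  note g = inv_arrow[OF f]
  have "ide C a \<cdot> h = ide C a \<cdot> k"
    using eq cmp_assoc[OF h(1) f(1) g(1)] cmp_assoc[OF h(2) f(1) g(1)] g(2) by simp
  then show ?thesis
    using h cmp_ide_left by simp
qed

end

section \<open>Morphisms of surjections, open systems, and families on an index set\<close>

lemma surj_arrows_obj: "a \<in> obj (surj_arrows C) \<Longrightarrow> a \<in> arr C"
  by (simp add: surj_arrows_def full_subcategory_def arrow_category_def)

lemma surj_arrows_cmp [simp]: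
  "tot (g \<cdot>\<^bsub>surj_arrows C\<^esub> f) = tot g \<cdot>\<^bsub>C\<^esub> tot f"
  "st (g \<cdot>\<^bsub>surj_arrows C\<^esub> f) = st g \<cdot>\<^bsub>C\<^esub> st f"
  "dom_ob (g \<cdot>\<^bsub>surj_arrows C\<^esub> f) = dom_ob f"
  "cod_ob (g \<cdot>\<^bsub>surj_arrows C\<^esub> f) = cod_ob g"
  by (simp_all add: surj_arrows_def full_subcategory_def arrow_category_def)

text \<open>Because the subcategory is full, surjectivity enters only through membership of
  \<open>a\<close> and \<open>b\<close> in \<open>obj (surj_arrows C)\<close>; what remains is a
  commuting square in \<open>C\<close>.\<close>

lemma hom_surj_arrows_iff:
  "f \<in> hom (surj_arrows C) a b \<longleftrightarrow>
     a \<in> obj (surj_arrows C) \<and> b \<in> obj (surj_arrows C) \<and> dom_ob f = a \<and> cod_ob f = b \<and>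
     tot f \<in> hom C (src C a) (src C b) \<and> st f \<in> hom C (tgt C a) (tgt C b) \<and>
     b \<cdot>\<^bsub>C\<^esub> tot f = st f \<cdot>\<^bsub>C\<^esub> a"
  by (auto simp: surj_arrows_def full_subcategory_def arrow_category_def hom_def)

lemma hom_surj_arrowsD:
  assumes "f \<in> hom (surj_arrows C) a b"
  shows "a \<in> obj (surj_arrows C)" "b \<in> obj (surj_arrows C)" "dom_ob f = a" "cod_ob f = b"
    "tot f \<in> hom C (src C a) (src C b)" "st f \<in> hom C (tgt C a) (tgt C b)"
    "b \<cdot>\<^bsub>C\<^esub> tot f = st f \<cdot>\<^bsub>C\<^esub> a"
  using assms by (simp_all add: hom_surj_arrows_iff)

lemma GamD:
  assumes "v \<in> Gam C a"
  shows "v \<in> hom C (src C a) (T_obj C (tgt C a))" "tau C (tgt C a) \<cdot>\<^bsub>C\<^esub> v = a"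
  using assms by (simp_all add: Gam_def)

lemma Gam_relD:
  assumes "(v, w) \<in> Gam_rel C f"
  shows "v \<in> Gam C (dom_ob f)" "w \<in> Gam C (cod_ob f)" "T_arr C (st f) \<cdot>\<^bsub>C\<^esub> v = w \<cdot>\<^bsub>C\<^esub> tot f"
  using assms by (simp_all add: Gam_rel_def)

text \<open>\<open>Prod\<close> restricts the family to \<open>I\<close> before choosing a product.
  This is what allows the sources and targets inside \<open>prod_arr\<close> to be replaced by
  families that agree with them on \<open>I\<close> only.\<close>

lemma Prod_cong: "(\<And>i. i \<in> I \<Longrightarrow> F i = G i) \<Longrightarrow> Prod C I F = Prod C I G"
  unfolding Prod_def by (metis restrict_ext)

lemma Proj_cong: "(\<And>i. i \<in> I \<Longrightarrow> F i = G i) \<Longrightarrow> Proj C I F = Proj C I G"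
  unfolding Proj_def by (metis restrict_ext)

text \<open>Indexing the two projections of a square by \<open>bool\<close> treats them uniformly;
  \<open>True\<close> is the first one, that is \<open>tau\<close>.\<close>

definition T_proj ::
  "('o, 'm, 'u, 'i, 'e) concrete_category_scheme \<Rightarrow> 'o \<Rightarrow> bool \<Rightarrow> 'm" where
  "T_proj C c = case_bool (bfst C c c) (bsnd C c c)"

lemma T_proj_True: "T_proj C c True = tau C c"
  by (simp add: T_proj_def tau_def)

section \<open>The squaring functor and its two projections\<close>

context concrete_category_with_products
begin

text \<open>The chosen binary product is already a product over \<open>bool\<close>; for equal
  factors its family \<open>case_bool c c\<close> is constant.\<close>

lemma T_product: "c \<in> obj C \<Longrightarrow> is_product C UNIV (\<lambda>_. c) (T_obj C c) (T_proj C c)"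
proof -
  have "case_bool c c = (\<lambda>_. c)"
    by (auto split: bool.split)
  then show "c \<in> obj C \<Longrightarrow> is_product C UNIV (\<lambda>_. c) (T_obj C c) (T_proj C c)"
    using binary_product[of c c] by (simp add: T_obj_def T_proj_def)
qed

lemma T_proj_hom: "c \<in> obj C \<Longrightarrow> T_proj C c b \<in> hom C (T_obj C c) c"
  using T_product[of c] by (simp add: is_product_def)

lemma T_ext:
  assumes "c \<in> obj C" "h \<in> hom C d (T_obj C c)" "k \<in> hom C d (T_obj C c)"
    and "\<And>b. T_proj C c b \<cdot> h = T_proj C c b \<cdot> k"
  shows "h = k"
  using product_ext[OF T_product[OF assms(1)] assms(2,3)] assms(4) by blast

lemma pair_arr_props:
  assumes f: "f \<in> hom C a c" and g: "g \<in> hom C a c"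
  shows pair_arr_hom: "pair_arr C f g \<in> hom C a (T_obj C c)"
    and T_proj_pair_arr: "T_proj C c b \<cdot> pair_arr C f g = case_bool f g b"
proof -
  have eq: "pair_arr C f g = mediating C UNIV (T_obj C c) (T_proj C c) a (case_bool f g)"
    using f g by (simp add: pair_arr_def T_obj_def T_proj_def homD)
  have fg: "\<forall>i\<in>UNIV. case_bool f g i \<in> hom C a c"
    using f g by (auto split: bool.split)
  then show "pair_arr C f g \<in> hom C a (T_obj C c)"
    and "T_proj C c b \<cdot> pair_arr C f g = case_bool f g b"
    unfolding eq
    using mediating_hom[OF T_product[OF hom_obj(2)[OF f]] hom_obj(1)[OF f] fg]
      proj_mediating[OF T_product[OF hom_obj(2)[OF f]] hom_obj(1)[OF f] fg, of b]
    by simp_all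
qed

text \<open>\<open>T_arr C f\<close> pairs the composites of \<open>f\<close> with the two
  projections, so both projections are natural; \<open>b = True\<close> is the naturality of
  \<open>tau\<close>.\<close>

lemma T_arr_props:
  assumes f: "f \<in> hom C a c"
  shows T_arr_hom: "T_arr C f \<in> hom C (T_obj C a) (T_obj C c)"
    and T_proj_T_arr: "T_proj C c b \<cdot> T_arr C f = f \<cdot> T_proj C a b"
proof -
  have eq: "T_arr C f = pair_arr C (f \<cdot> T_proj C a True) (f \<cdot> T_proj C a False)"
    using f by (simp add: T_arr_def T_proj_def homD)
  have p: "f \<cdot> T_proj C a i \<in> hom C (T_obj C a) c" for i
    using cmp_hom[OF T_proj_hom f] hom_obj(1)[OF f] by blast
  show "T_arr C f \<in> hom C (T_obj C a) (T_obj C c)"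
    unfolding eq by (rule pair_arr_hom[OF p p])
  show "T_proj C c b \<cdot> T_arr C f = f \<cdot> T_proj C a b"
    unfolding eq T_proj_pair_arr[OF p p] by (cases b) auto
qed

text \<open>After the projection \<open>i\<close>, both sides become
  \<open>g \<cdot> (f \<cdot> T_proj C a i)\<close>.\<close>

lemma T_arr_cmp:
  assumes f: "f \<in> hom C a b" and g: "g \<in> hom C b c"
  shows "T_arr C (g \<cdot> f) = T_arr C g \<cdot> T_arr C f"
proof (rule T_ext)
  note o = hom_obj[OF f] hom_obj[OF g]
  note gf = cmp_hom[OF f g]
  show "c \<in> obj C"
    by (fact o)
  show "T_arr C (g \<cdot> f) \<in> hom C (T_obj C a) (T_obj C c)"
    by (rule T_arr_hom[OF gf])
  show "T_arr C g \<cdot> T_arr C f \<in> hom C (T_obj C a) (T_obj C c)"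
    by (rule cmp_hom[OF T_arr_hom[OF f] T_arr_hom[OF g]])
  fix i
  have "T_proj C c i \<cdot> (T_arr C g \<cdot> T_arr C f) = (g \<cdot> T_proj C b i) \<cdot> T_arr C f"
    using cmp_assoc[OF T_arr_hom[OF f] T_arr_hom[OF g] T_proj_hom] o T_proj_T_arr[OF g] by simp
  also have "\<dots> = g \<cdot> (f \<cdot> T_proj C a i)"
    using cmp_assoc[OF T_arr_hom[OF f] T_proj_hom g] o T_proj_T_arr[OF f] by simp
  also have "\<dots> = T_proj C c i \<cdot> T_arr C (g \<cdot> f)"
    using cmp_assoc[OF T_proj_hom f g] o T_proj_T_arr[OF gf] by simp
  finally show "T_proj C c i \<cdot> T_arr C (g \<cdot> f) = T_proj C c i \<cdot> (T_arr C g \<cdot> T_arr C f)"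
    by simp
qed

lemma T_arr_ide:
  assumes c: "c \<in> obj C"
  shows "T_arr C (ide C c) = ide C (T_obj C c)"
proof (rule T_ext[OF c])
  have T: "T_obj C c \<in> obj C"
    using hom_obj(1)[OF T_proj_hom[OF c]] .
  show "T_arr C (ide C c) \<in> hom C (T_obj C c) (T_obj C c)"
    by (rule T_arr_hom[OF ide_hom[OF c]])
  show "ide C (T_obj C c) \<in> hom C (T_obj C c) (T_obj C c)"
    by (rule ide_hom[OF T])
  show "T_proj C c i \<cdot> T_arr C (ide C c) = T_proj C c i \<cdot> ide C (T_obj C c)" for i
    using T_proj_T_arr[OF ide_hom[OF c]] cmp_ide_left[OF T_proj_hom[OF c]]
      cmp_ide_right[OF T_proj_hom[OF c]] by simp
qed

text \<open>Functors preserve inverses. This makes the inverse in \<open>Gam_fun\<close> genuine and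
  rewrites it as the square of a morphism, to which naturality of the projections applies.\<close>

lemma T_arr_inv:
  assumes f: "f \<in> hom C a b" "iso_arrow C f"
  shows iso_T_arr: "iso_arrow C (T_arr C f)"
    and inv_T_arr: "inv_arrow C (T_arr C f) = T_arr C (inv_arrow C f)"
proof -
  note g = inv_arrow[OF f]
  have "inverse_arrows C (T_arr C f) (T_arr C (inv_arrow C f))"
    using T_arr_hom[OF f(1)] T_arr_hom[OF g(1)] T_arr_cmp[OF f(1) g(1)] T_arr_cmp[OF g(1) f(1)]
      g(2,3) T_arr_ide hom_obj[OF f(1)]
    by (auto simp: inverse_arrows_def homD)
  then show "iso_arrow C (T_arr C f)" "inv_arrow C (T_arr C f) = T_arr C (inv_arrow C f)"
    using inv_arrow_eq by (auto simp: iso_arrow_def)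
qed

section \<open>Finite products and the map from families of systems to systems on the
  product\<close>

lemma Prod_product:
  assumes "finite I" "\<forall>i\<in>I. F i \<in> obj C"
  shows "is_product C I F (Prod C I F) (Proj C I F)"
proof -
  have "is_product C I (restrict F I) (Prod C I F) (Proj C I F)"
    using finite_product[of I "restrict F I"] assms by (simp add: Prod_def Proj_def)
  then show ?thesis
    by (simp add: is_product_def)
qed

lemma Proj_hom:
  assumes "finite I" "\<forall>i\<in>I. F i \<in> obj C" "i \<in> I"
  shows "Proj C I F i \<in> hom C (Prod C I F) (F i)"
  using Prod_product[OF assms(1,2)] assms(3) by (auto simp: is_product_def)

text \<open>The families \<open>s\<close> and \<open>t\<close> are free, so that later uses can
  choose them, for instance squares \<open>T_obj C (F i)\<close>, instead of expressions in
  \<open>src\<close> and \<open>tgt\<close>.\<close>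

lemma prod_arr_props:
  assumes I: "finite I" and f: "\<forall>i\<in>I. f i \<in> hom C (s i) (t i)"
  shows prod_arr_hom: "prod_arr C I f \<in> hom C (Prod C I s) (Prod C I t)"
    and Proj_prod_arr: "i \<in> I \<Longrightarrow> Proj C I t i \<cdot> prod_arr C I f = f i \<cdot> Proj C I s i"
proof -
  have o: "\<forall>i\<in>I. s i \<in> obj C" "\<forall>i\<in>I. t i \<in> obj C"
    using f hom_obj by blast+
  have ps: "is_product C I s (Prod C I s) (Proj C I s)"
    and pt: "is_product C I t (Prod C I t) (Proj C I t)"
    using Prod_product[OF I] o by blast+
  have s: "Prod C I (\<lambda>i. src C (f i)) = Prod C I s" "Proj C I (\<lambda>i. src C (f i)) = Proj C I s"
    and t: "Prod C I (\<lambda>i. tgt C (f i)) = Prod C I t" "Proj C I (\<lambda>i. tgt C (f i)) = Proj C I t"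
    using f by (auto simp: homD intro!: Prod_cong Proj_cong)
  have P: "Prod C I s \<in> obj C"
    using ps by (simp add: is_product_def)
  have g: "\<forall>i\<in>I. f i \<cdot> Proj C I s i \<in> hom C (Prod C I s) (t i)"
    using cmp_hom[OF Proj_hom[OF I o(1)] bspec[OF f]] by simp
  have eq: "prod_arr C I f =
      mediating C I (Prod C I t) (Proj C I t) (Prod C I s) (\<lambda>i. f i \<cdot> Proj C I s i)"
    by (simp add: prod_arr_def s t)
  show "prod_arr C I f \<in> hom C (Prod C I s) (Prod C I t)"
    unfolding eq by (rule mediating_hom[OF pt P g])
  show "Proj C I t i \<cdot> prod_arr C I f = f i \<cdot> Proj C I s i" if "i \<in> I"
    unfolding eq by (rule proj_mediating[OF pt P g that])
qed

text \<open>The canonical isomorphism is a pairing of products of projections, so composing it with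
  a projection of the square gives back the product of the corresponding projections of the
  factors.\<close>

lemma T_prod_iso_props:
  assumes I: "finite I" and F: "\<forall>i\<in>I. F i \<in> obj C"
  shows T_prod_iso_hom: "T_prod_iso C I F \<in> hom C (Prod C I (\<lambda>i. T_obj C (F i))) (T_obj C (Prod C I F))"
    and T_proj_T_prod_iso:
      "T_proj C (Prod C I F) b \<cdot> T_prod_iso C I F = prod_arr C I (\<lambda>i. T_proj C (F i) b)"
proof -
  have eq: "T_prod_iso C I F =
      pair_arr C (prod_arr C I (\<lambda>i. T_proj C (F i) True)) (prod_arr C I (\<lambda>i. T_proj C (F i) False))"
    by (simp add: T_prod_iso_def T_proj_def)
  have p: "prod_arr C I (\<lambda>i. T_proj C (F i) b) \<in> hom C (Prod C I (\<lambda>i. T_obj C (F i))) (Prod C I F)" for b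
    using F by (intro prod_arr_hom[OF I]) (blast intro: T_proj_hom)
  show "T_prod_iso C I F \<in> hom C (Prod C I (\<lambda>i. T_obj C (F i))) (T_obj C (Prod C I F))"
    unfolding eq by (rule pair_arr_hom[OF p p])
  show "T_proj C (Prod C I F) b \<cdot> T_prod_iso C I F = prod_arr C I (\<lambda>i. T_proj C (F i) b)"
    unfolding eq T_proj_pair_arr[OF p p] by (cases b) auto
qed

text \<open>The projection \<open>b\<close> crosses \<open>T_prod_iso\<close> and becomes a product
  of projections; then \<open>Proj\<close> picks out the factor \<open>i\<close>, first there and
  then in \<open>prod_arr C I v\<close>. Ranging over all \<open>i\<close> and \<open>b\<close>,
  these equations determine \<open>P_map C I D v\<close>.\<close>

lemma P_map_props:
  assumes I: "finite I" and D: "\<forall>i\<in>I. D i \<in> arr C"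
    and v: "\<forall>i\<in>I. v i \<in> hom C (src C (D i)) (T_obj C (tgt C (D i)))"
  defines "S \<equiv> \<lambda>i. src C (D i)" and "F \<equiv> \<lambda>i. tgt C (D i)"
  shows P_map_hom: "P_map C I D v \<in> hom C (Prod C I S) (T_obj C (Prod C I F))"
    and Proj_P_map: "i \<in> I \<Longrightarrow> Proj C I F i \<cdot> (T_proj C (Prod C I F) b \<cdot> P_map C I D v) =
           T_proj C (F i) b \<cdot> (v i \<cdot> Proj C I S i)"
proof -
  have o: "\<forall>i\<in>I. F i \<in> obj C" "\<forall>i\<in>I. S i \<in> obj C"
    using D src_obj tgt_obj by (auto simp: S_def F_def)
  have v': "\<forall>i\<in>I. v i \<in> hom C (S i) (T_obj C (F i))"
    using v by (simp add: S_def F_def)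
  have To: "\<forall>i\<in>I. T_obj C (F i) \<in> obj C"
    using v' hom_obj(2) by blast
  have PF: "Prod C I F \<in> obj C"
    using Prod_product[OF I o(1)] by (simp add: is_product_def)
  have eq: "P_map C I D v = T_prod_iso C I F \<cdot> prod_arr C I v"
    by (simp add: P_map_def F_def)
  have pv: "prod_arr C I v \<in> hom C (Prod C I S) (Prod C I (\<lambda>i. T_obj C (F i)))"
    using prod_arr_hom[OF I v'] .
  have ti: "T_prod_iso C I F \<in> hom C (Prod C I (\<lambda>i. T_obj C (F i))) (T_obj C (Prod C I F))"
    using T_prod_iso_hom[OF I o(1)] .
  show "P_map C I D v \<in> hom C (Prod C I S) (T_obj C (Prod C I F))"
    unfolding eq by (rule cmp_hom[OF pv ti])
  assume i: "i \<in> I"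
  have tp: "\<forall>i\<in>I. T_proj C (F i) b \<in> hom C (T_obj C (F i)) (F i)"
    using T_proj_hom o by blast
  have pr: "Proj C I F i \<in> hom C (Prod C I F) (F i)"
    using Proj_hom[OF I o(1) i] .
  have prT: "Proj C I (\<lambda>i. T_obj C (F i)) i \<in> hom C (Prod C I (\<lambda>i. T_obj C (F i))) (T_obj C (F i))"
    using Proj_hom[OF I To i] .
  have "Proj C I F i \<cdot> (T_proj C (Prod C I F) b \<cdot> P_map C I D v) =
      (Proj C I F i \<cdot> prod_arr C I (\<lambda>i. T_proj C (F i) b)) \<cdot> prod_arr C I v"
    using cmp_assoc[OF pv ti T_proj_hom[OF PF]] T_proj_T_prod_iso[OF I o(1)]
      cmp_assoc[OF pv prod_arr_hom[OF I tp] pr] by (simp add: eq)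
  also have "\<dots> = T_proj C (F i) b \<cdot> (Proj C I (\<lambda>i. T_obj C (F i)) i \<cdot> prod_arr C I v)"
    using Proj_prod_arr[OF I tp i] cmp_assoc[OF pv prT bspec[OF tp i]] by simp
  also have "\<dots> = T_proj C (F i) b \<cdot> (v i \<cdot> Proj C I S i)"
    using Proj_prod_arr[OF I v' i] by simp
  finally show "Proj C I F i \<cdot> (T_proj C (Prod C I F) b \<cdot> P_map C I D v) =
      T_proj C (F i) b \<cdot> (v i \<cdot> Proj C I S i)" .
qed

lemma prod_arr_src_tgt:
  assumes "finite I" "\<forall>i\<in>I. D i \<in> arr C"
  shows "prod_arr C I D \<in> hom C (Prod C I (\<lambda>i. src C (D i))) (Prod C I (\<lambda>i. tgt C (D i)))"
  using assms by (intro prod_arr_hom) (auto simp: hom_def)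

text \<open>The section condition is compared componentwise: at \<open>i\<close> it reduces to the
  section condition of \<open>v i\<close>.\<close>

lemma P_map_Gam:
  assumes I: "finite I" and D: "\<forall>i\<in>I. D i \<in> arr C"
    and v: "\<forall>i\<in>I. v i \<in> Gam C (D i)"
  shows "P_map C I D v \<in> Gam C (prod_arr C I D)"
proof -
  define S where "S = (\<lambda>i. src C (D i))"
  define F where "F = (\<lambda>i. tgt C (D i))"
  have o: "\<forall>i\<in>I. F i \<in> obj C" "\<forall>i\<in>I. S i \<in> obj C"
    using D src_obj tgt_obj by (auto simp: S_def F_def)
  have D': "\<forall>i\<in>I. D i \<in> hom C (S i) (F i)"
    using D by (simp add: hom_def S_def F_def)
  have v': "\<forall>i\<in>I. v i \<in> hom C (src C (D i)) (T_obj C (tgt C (D i)))"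
    using v by (simp add: Gam_def)
  have pD: "prod_arr C I D \<in> hom C (Prod C I S) (Prod C I F)"
    by (rule prod_arr_hom[OF I D'])
  have Pv: "P_map C I D v \<in> hom C (Prod C I S) (T_obj C (Prod C I F))"
    unfolding S_def F_def by (rule P_map_hom[OF I D v'])
  have "T_proj C (Prod C I F) True \<cdot> P_map C I D v = prod_arr C I D"
  proof (rule product_ext[OF Prod_product[OF I o(1)]])
    show "T_proj C (Prod C I F) True \<cdot> P_map C I D v \<in> hom C (Prod C I S) (Prod C I F)"
      using cmp_hom[OF Pv T_proj_hom] hom_obj(2)[OF pD] by blast
    show "prod_arr C I D \<in> hom C (Prod C I S) (Prod C I F)"
      by (fact pD)
    fix i assume i: "i \<in> I"
    have vi: "v i \<in> hom C (S i) (T_obj C (F i))" "T_proj C (F i) True \<cdot> v i = D i"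
      using GamD[OF bspec[OF v i]] by (simp_all add: S_def F_def T_proj_True)
    have "Proj C I F i \<cdot> (T_proj C (Prod C I F) True \<cdot> P_map C I D v) =
        T_proj C (F i) True \<cdot> (v i \<cdot> Proj C I S i)"
      unfolding S_def F_def by (rule Proj_P_map[OF I D v' i])
    also have "\<dots> = D i \<cdot> Proj C I S i"
      using cmp_assoc[OF Proj_hom[OF I o(2) i] vi(1) T_proj_hom[OF bspec[OF o(1) i]], of True] vi(2) by simp
    also have "\<dots> = Proj C I F i \<cdot> prod_arr C I D"
      using Proj_prod_arr[OF I D' i] by simp
    finally show "Proj C I F i \<cdot> (T_proj C (Prod C I F) True \<cdot> P_map C I D v) =
        Proj C I F i \<cdot> prod_arr C I D" .
  qed
  then show ?thesis
    using Pv homD(2,3)[OF pD] by (simp add: Gam_def T_proj_True)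
qed

section \<open>Pulling systems back along interconnections\<close>

text \<open>By naturality of \<open>tau\<close>, the inverse of \<open>st i\<close> moves to the
  front; the section condition of \<open>w\<close> and the commuting square of \<open>i\<close> then
  leave \<open>st i\<close> next to its inverse. The second claim makes \<open>Gam_fun C i w\<close>
  and \<open>w\<close> an \<open>i\<close>-related pair, which avoids the inverse in later
  computations.\<close>

lemma Gam_fun_props:
  assumes i: "i \<in> hom (surj_arrows C) a b" "iso_arrow C (st i)" and w: "w \<in> Gam C b"
  shows Gam_fun_Gam: "Gam_fun C i w \<in> Gam C a"
    and T_arr_Gam_fun: "T_arr C (st i) \<cdot> Gam_fun C i w = w \<cdot> tot i"
proof -
  note h = hom_surj_arrowsD[OF i(1)]
  note w' = GamD[OF w]
  note g = inv_arrow[OF h(6) i(2)]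
  note T = T_arr_hom[OF h(6)] and Ti = T_arr_hom[OF g(1)]
  have a: "a \<in> hom C (src C a) (tgt C a)"
    using surj_arrows_obj[OF h(1)] by (simp add: hom_def)
  have o: "tgt C a \<in> obj C" "tgt C b \<in> obj C"
    using hom_obj[OF h(6)] .
  have wt: "w \<cdot> tot i \<in> hom C (src C a) (T_obj C (tgt C b))"
    using cmp_hom[OF h(5) w'(1)] .
  have eq: "Gam_fun C i w = T_arr C (inv_arrow C (st i)) \<cdot> (w \<cdot> tot i)"
    by (simp add: Gam_fun_def inv_T_arr[OF h(6) i(2)])
  show "T_arr C (st i) \<cdot> Gam_fun C i w = w \<cdot> tot i"
    using cmp_assoc[OF wt Ti T] T_arr_cmp[OF g(1) h(6)] g(3) T_arr_ide[OF o(2)] cmp_ide_left[OF wt]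
    by (simp add: eq)
  have "T_proj C (tgt C a) True \<cdot> Gam_fun C i w =
      (inv_arrow C (st i) \<cdot> T_proj C (tgt C b) True) \<cdot> (w \<cdot> tot i)"
    using cmp_assoc[OF wt Ti T_proj_hom[OF o(1)], of True] T_proj_T_arr[OF g(1), of True] by (simp add: eq)
  also have "\<dots> = inv_arrow C (st i) \<cdot> ((T_proj C (tgt C b) True \<cdot> w) \<cdot> tot i)"
    using cmp_assoc[OF wt T_proj_hom[OF o(2)] g(1), of True]
      cmp_assoc[OF h(5) w'(1) T_proj_hom[OF o(2)], of True] by simp
  also have "\<dots> = (inv_arrow C (st i) \<cdot> st i) \<cdot> a"
    using w'(2) h(7) cmp_assoc[OF a h(6) g(1)] by (simp add: T_proj_True)
  also have "\<dots> = a"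
    using g(2) cmp_ide_left[OF a] by simp
  finally have "tau C (tgt C a) \<cdot> Gam_fun C i w = a"
    by (simp only: T_proj_True)
  moreover have "Gam_fun C i w \<in> hom C (src C a) (T_obj C (tgt C a))"
    unfolding eq by (rule cmp_hom[OF wt Ti])
  ultimately show "Gam_fun C i w \<in> Gam C a"
    unfolding Gam_def by blast
qed

section \<open>Products in the category of surjections\<close>

text \<open>The square of the projection commutes by \<open>Proj_prod_arr\<close>. Surjectivity of
  the product arrow is assumed as \<open>P\<close>, since the underlying-set functor need not
  preserve products.\<close>

lemma A_proj_hom:
  assumes I: "finite I" and D: "\<forall>i\<in>I. D i \<in> obj (surj_arrows C)"
    and P: "prod_arr C I D \<in> obj (surj_arrows C)" and i: "i \<in> I"
  shows "A_proj C I D i \<in> hom (surj_arrows C) (prod_arr C I D) (D i)"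
proof -
  have D': "\<forall>i\<in>I. D i \<in> hom C (src C (D i)) (tgt C (D i))"
    using D by (auto simp: hom_def dest: surj_arrows_obj)
  then have o: "\<forall>i\<in>I. src C (D i) \<in> obj C" "\<forall>i\<in>I. tgt C (D i) \<in> obj C"
    using hom_obj by blast+
  show ?thesis
    using D P i homD[OF prod_arr_hom[OF I D']] Proj_prod_arr[OF I D' i]
      Proj_hom[OF I o(1) i] Proj_hom[OF I o(2) i]
    by (simp add: hom_surj_arrows_iff A_proj_def)
qed

text \<open>Products in an arrow category are formed separately on total and state parts. Fullness
  carries this over to the subcategory once the product arrow lies in it.\<close>

lemma surj_arrows_product:
  assumes I: "finite I" and D: "\<forall>i\<in>I. D i \<in> obj (surj_arrows C)"
    and P: "prod_arr C I D \<in> obj (surj_arrows C)"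
  shows "is_product (surj_arrows C) I D (prod_arr C I D) (A_proj C I D)"
proof -
  define S where "S = (\<lambda>i. src C (D i))"
  define F where "F = (\<lambda>i. tgt C (D i))"
  have D': "\<forall>i\<in>I. D i \<in> hom C (S i) (F i)"
    using D by (auto simp: hom_def S_def F_def dest: surj_arrows_obj)
  then have oS: "\<forall>i\<in>I. S i \<in> obj C" and oF: "\<forall>i\<in>I. F i \<in> obj C"
    using hom_obj by blast+
  note pS = Prod_product[OF I oS] and pF = Prod_product[OF I oF]
  have pD: "prod_arr C I D \<in> hom C (Prod C I S) (Prod C I F)"
    by (rule prod_arr_hom[OF I D'])
  have A: "tot (A_proj C I D i) = Proj C I S i" "st (A_proj C I D i) = Proj C I F i" for i
    by (simp_all add: A_proj_def S_def F_def)
  have ex1: "\<exists>!h. h \<in> hom (surj_arrows C) c (prod_arr C I D) \<and>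
      (\<forall>i\<in>I. A_proj C I D i \<cdot>\<^bsub>surj_arrows C\<^esub> h = g i)"
    if c: "c \<in> obj (surj_arrows C)" and g: "\<forall>i\<in>I. g i \<in> hom (surj_arrows C) c (D i)"
    for c g
  proof -
    have c': "c \<in> hom C (src C c) (tgt C c)"
      using surj_arrows_obj[OF c] by (simp add: hom_def)
    note co = hom_obj[OF c']
    have gt: "\<forall>i\<in>I. tot (g i) \<in> hom C (src C c) (S i)"
      and gs: "\<forall>i\<in>I. st (g i) \<in> hom C (tgt C c) (F i)"
      and gc: "\<forall>i\<in>I. D i \<cdot> tot (g i) = st (g i) \<cdot> c"
      using g by (simp_all add: hom_surj_arrows_iff S_def F_def)
    define t where "t = mediating C I (Prod C I S) (Proj C I S) (src C c) (\<lambda>i. tot (g i))"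
    define s where "s = mediating C I (Prod C I F) (Proj C I F) (tgt C c) (\<lambda>i. st (g i))"
    have t: "t \<in> hom C (src C c) (Prod C I S)" "\<And>i. i \<in> I \<Longrightarrow> Proj C I S i \<cdot> t = tot (g i)"
      unfolding t_def using mediating_hom[OF pS co(1) gt] proj_mediating[OF pS co(1) gt] by auto
    have s: "s \<in> hom C (tgt C c) (Prod C I F)" "\<And>i. i \<in> I \<Longrightarrow> Proj C I F i \<cdot> s = st (g i)"
      unfolding s_def using mediating_hom[OF pF co(2) gs] proj_mediating[OF pF co(2) gs] by auto
    \<comment> \<open>The two separately obtained mediating morphisms form a square over
      \<open>c\<close>: its commutativity is tested at each \<open>i\<close>, where it is the square
      of \<open>g i\<close>.\<close>
    have "prod_arr C I D \<cdot> t = s \<cdot> c"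
    proof (rule product_ext[OF pF])
      show "prod_arr C I D \<cdot> t \<in> hom C (src C c) (Prod C I F)"
        by (rule cmp_hom[OF t(1) pD])
      show "s \<cdot> c \<in> hom C (src C c) (Prod C I F)"
        by (rule cmp_hom[OF c' s(1)])
      fix i assume i: "i \<in> I"
      have "Proj C I F i \<cdot> (prod_arr C I D \<cdot> t) = (D i \<cdot> Proj C I S i) \<cdot> t"
        using cmp_assoc[OF t(1) pD Proj_hom[OF I oF i]] Proj_prod_arr[OF I D' i] by simp
      also have "\<dots> = st (g i) \<cdot> c"
        using cmp_assoc[OF t(1) Proj_hom[OF I oS i] bspec[OF D' i]] t(2)[OF i] bspec[OF gc i] by simp
      also have "\<dots> = Proj C I F i \<cdot> (s \<cdot> c)"
        using cmp_assoc[OF c' s(1) Proj_hom[OF I oF i]] s(2)[OF i] by simp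
      finally show "Proj C I F i \<cdot> (prod_arr C I D \<cdot> t) = Proj C I F i \<cdot> (s \<cdot> c)" .
    qed
    then have h: "\<lparr>dom_ob = c, cod_ob = prod_arr C I D, tot = t, st = s\<rparr>
        \<in> hom (surj_arrows C) c (prod_arr C I D)" (is "?h \<in> _")
      using c P t(1) s(1) pD by (simp add: hom_surj_arrows_iff homD)
    show ?thesis
    proof (intro ex1I[of _ ?h] conjI ballI h)
      fix i assume i: "i \<in> I"
      show "A_proj C I D i \<cdot>\<^bsub>surj_arrows C\<^esub> ?h = g i"
        using t(2)[OF i] s(2)[OF i] hom_surj_arrowsD(3,4)[OF bspec[OF g i]]
        by (intro arrow_mor.equality) (simp_all add: A, simp_all add: A_proj_def)
    next
      fix k assume k: "k \<in> hom (surj_arrows C) c (prod_arr C I D) \<and>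
          (\<forall>i\<in>I. A_proj C I D i \<cdot>\<^bsub>surj_arrows C\<^esub> k = g i)"
      note kD = hom_surj_arrowsD[OF conjunct1[OF k]]
      \<comment> \<open>Uniqueness also splits: the two parts of \<open>k\<close> have the same
        components as \<open>t\<close> and \<open>s\<close>.\<close>
      have "Proj C I S i \<cdot> tot k = tot (g i)" "Proj C I F i \<cdot> st k = st (g i)" if "i \<in> I" for i
        using k that A surj_arrows_cmp[of C "A_proj C I D i" k] by (metis, metis)
      then have "tot k = t" "st k = s"
        using product_ext[OF pS _ t(1), of "tot k"] product_ext[OF pF _ s(1), of "st k"]
          t(2) s(2) kD(5,6) pD by (simp_all add: homD)
      then show "k = ?h"
        using kD(3,4) by simp
    qed
  qed
  show ?thesis
    unfolding is_product_def using P A_proj_hom[OF I D P] ex1 by blast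
qed

section \<open>Networks and the induced map of products\<close>

lemma is_networkD:
  assumes "is_network C N"
  shows "finite (nodes N)" "\<forall>x\<in>nodes N. sys N x \<in> obj (surj_arrows C)"
    "\<forall>x\<in>nodes N. sys N x \<in> arr C"
    "inter N \<in> hom (surj_arrows C) (dom_ob (inter N)) (prod_arr C (nodes N) (sys N))"
    "iso_arrow C (st (inter N))" "prod_arr C (nodes N) (sys N) \<in> obj (surj_arrows C)"
  using assms
  by (auto simp: is_network_def interconnection_def hom_surj_arrows_iff dest: surj_arrows_obj)

text \<open>\<open>Pi_map\<close> is a mediating morphism in \<open>surj_arrows C\<close>, well
  defined by \<open>surj_arrows_product\<close>. Taking \<open>tot\<close> and \<open>st\<close> of
  its defining equations turns them into equations in \<open>C\<close>.\<close>

lemma Pi_map_props: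
  assumes M: "is_network C M" and N: "is_network C N" and \<phi>: "\<phi> \<in> nodes M \<rightarrow> nodes N"
    and \<Phi>: "\<forall>x\<in>nodes M. \<Phi> x \<in> hom (surj_arrows C) (sys N (\<phi> x)) (sys M x)"
  shows Pi_map_hom: "Pi_map C M N \<phi> \<Phi> \<in>
      hom (surj_arrows C) (prod_arr C (nodes N) (sys N)) (prod_arr C (nodes M) (sys M))"
    and Proj_tot_Pi_map: "x \<in> nodes M \<Longrightarrow>
      Proj C (nodes M) (\<lambda>x. src C (sys M x)) x \<cdot> tot (Pi_map C M N \<phi> \<Phi>) =
      tot (\<Phi> x) \<cdot> Proj C (nodes N) (\<lambda>y. src C (sys N y)) (\<phi> x)"
    and Proj_st_Pi_map: "x \<in> nodes M \<Longrightarrow>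
      Proj C (nodes M) (\<lambda>x. tgt C (sys M x)) x \<cdot> st (Pi_map C M N \<phi> \<Phi>) =
      st (\<Phi> x) \<cdot> Proj C (nodes N) (\<lambda>y. tgt C (sys N y)) (\<phi> x)"
proof -
  note m = is_networkD[OF M] and n = is_networkD[OF N]
  note pM = surj_arrows_product[OF m(1,2,6)]
  let ?g = "\<lambda>x. \<Phi> x \<cdot>\<^bsub>surj_arrows C\<^esub> A_proj C (nodes N) (sys N) (\<phi> x)"
  have g: "\<forall>x\<in>nodes M. ?g x \<in> hom (surj_arrows C) (prod_arr C (nodes N) (sys N)) (sys M x)"
  proof
    fix x assume x: "x \<in> nodes M"
    have y: "\<phi> x \<in> nodes N"
      using \<phi> x by blast
    note p = hom_surj_arrowsD[OF A_proj_hom[OF n(1,2,6) y]]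
    note q = hom_surj_arrowsD[OF bspec[OF \<Phi> x]]
    have P: "prod_arr C (nodes N) (sys N) \<in> hom C (src C (prod_arr C (nodes N) (sys N)))
        (tgt C (prod_arr C (nodes N) (sys N)))"
      using surj_arrows_obj[OF n(6)] by (simp add: hom_def)
    have Dy: "sys N (\<phi> x) \<in> hom C (src C (sys N (\<phi> x))) (tgt C (sys N (\<phi> x)))"
      and Dx: "sys M x \<in> hom C (src C (sys M x)) (tgt C (sys M x))"
      using bspec[OF n(3) y] bspec[OF m(3) x] by (simp_all add: hom_def)
    \<comment> \<open>The square of the composite is pasted from the squares of the projection and
      of \<open>\<Phi> x\<close>.\<close>
    show "?g x \<in> hom (surj_arrows C) (prod_arr C (nodes N) (sys N)) (sys M x)"
      using p q cmp_hom[OF p(5) q(5)] cmp_hom[OF p(6) q(6)] cmp_assoc[OF p(5) q(5) Dx]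
        cmp_assoc[OF p(5) Dy q(6)] cmp_assoc[OF P p(6) q(6)]
      by (simp add: hom_surj_arrows_iff)
  qed
  show "Pi_map C M N \<phi> \<Phi> \<in>
      hom (surj_arrows C) (prod_arr C (nodes N) (sys N)) (prod_arr C (nodes M) (sys M))"
    unfolding Pi_map_def by (rule mediating_hom[OF pM n(6) g])
  have "A_proj C (nodes M) (sys M) x \<cdot>\<^bsub>surj_arrows C\<^esub> Pi_map C M N \<phi> \<Phi> = ?g x"
    if "x \<in> nodes M" for x
    unfolding Pi_map_def by (rule proj_mediating[OF pM n(6) g that])
  then have "tot (A_proj C (nodes M) (sys M) x \<cdot>\<^bsub>surj_arrows C\<^esub> Pi_map C M N \<phi> \<Phi>) = tot (?g x)"
    "st (A_proj C (nodes M) (sys M) x \<cdot>\<^bsub>surj_arrows C\<^esub> Pi_map C M N \<phi> \<Phi>) = st (?g x)"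
    if "x \<in> nodes M" for x
    using that by simp_all
  then show "x \<in> nodes M \<Longrightarrow>
      Proj C (nodes M) (\<lambda>x. src C (sys M x)) x \<cdot> tot (Pi_map C M N \<phi> \<Phi>) =
      tot (\<Phi> x) \<cdot> Proj C (nodes N) (\<lambda>y. src C (sys N y)) (\<phi> x)"
    and "x \<in> nodes M \<Longrightarrow>
      Proj C (nodes M) (\<lambda>x. tgt C (sys M x)) x \<cdot> st (Pi_map C M N \<phi> \<Phi>) =
      st (\<Phi> x) \<cdot> Proj C (nodes N) (\<lambda>y. tgt C (sys N y)) (\<phi> x)"
    by (simp_all add: A_proj_def)
qed

text \<open>This says that the product systems are \<open>Pi_map\<close>-related. Tested at node
  \<open>x\<close> and projection \<open>b\<close>, the left side involves only
  \<open>w (\<phi> x)\<close> and the right side only \<open>v x\<close>.\<close>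

lemma P_map_natural:
  assumes M: "is_network C M" and N: "is_network C N" and \<phi>: "\<phi> \<in> nodes M \<rightarrow> nodes N"
    and \<Phi>: "\<forall>x\<in>nodes M. \<Phi> x \<in> hom (surj_arrows C) (sys N (\<phi> x)) (sys M x)"
    and w: "\<forall>y\<in>nodes N. w y \<in> Gam C (sys N y)"
    and v: "\<forall>x\<in>nodes M. v x \<in> Gam C (sys M x)"
    and rel: "\<forall>x\<in>nodes M. (w (\<phi> x), v x) \<in> Gam_rel C (\<Phi> x)"
  shows "T_arr C (st (Pi_map C M N \<phi> \<Phi>)) \<cdot> P_map C (nodes N) (sys N) w =
         P_map C (nodes M) (sys M) v \<cdot> tot (Pi_map C M N \<phi> \<Phi>)"
proof -
  note m = is_networkD[OF M] and n = is_networkD[OF N]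
  \<comment> \<open>\<open>I\<close> and the unprimed families belong to \<open>M\<close>,
    \<open>J\<close> and the primed ones to \<open>N\<close>; \<open>pt\<close> and
    \<open>ps\<close> are the two parts of the induced map of products.\<close>
  define I J where "I = nodes M" and "J = nodes N"
  define S F where "S = (\<lambda>x. src C (sys M x))" and "F = (\<lambda>x. tgt C (sys M x))"
  define S' F' where "S' = (\<lambda>y. src C (sys N y))" and "F' = (\<lambda>y. tgt C (sys N y))"
  define pt ps where "pt = tot (Pi_map C M N \<phi> \<Phi>)" and "ps = st (Pi_map C M N \<phi> \<Phi>)"
  define Pw Pv where "Pw = P_map C J (sys N) w" and "Pv = P_map C I (sys M) v"
  note defs = I_def J_def S_def F_def S'_def F'_def pt_def ps_def Pw_def Pv_def
  have fin: "finite I" "finite J"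
    using m(1) n(1) by (simp_all add: defs)
  have o: "\<forall>x\<in>I. F x \<in> obj C" "\<forall>x\<in>I. S x \<in> obj C"
    using m(3) src_obj tgt_obj by (auto simp: defs)
  have o': "\<forall>y\<in>J. F' y \<in> obj C" "\<forall>y\<in>J. S' y \<in> obj C"
    using n(3) src_obj tgt_obj by (auto simp: defs)
  have w': "\<forall>y\<in>nodes N. w y \<in> hom C (src C (sys N y)) (T_obj C (tgt C (sys N y)))"
    and v': "\<forall>x\<in>nodes M. v x \<in> hom C (src C (sys M x)) (T_obj C (tgt C (sys M x)))"
    using w v by (simp_all add: Gam_def)
  have PD: "prod_arr C I (sys M) \<in> hom C (Prod C I S) (Prod C I F)"
    "prod_arr C J (sys N) \<in> hom C (Prod C J S') (Prod C J F')"
    unfolding defs by (rule prod_arr_src_tgt[OF m(1,3)], rule prod_arr_src_tgt[OF n(1,3)])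
  have pt: "pt \<in> hom C (Prod C J S') (Prod C I S)" and ps: "ps \<in> hom C (Prod C J F') (Prod C I F)"
    using hom_surj_arrowsD(5,6)[OF Pi_map_hom[OF M N \<phi> \<Phi>]] homD[OF PD(1)] homD[OF PD(2)]
    unfolding defs by simp_all
  have Pw: "Pw \<in> hom C (Prod C J S') (T_obj C (Prod C J F'))"
    unfolding defs by (rule P_map_hom[OF n(1,3) w'])
  have Pv: "Pv \<in> hom C (Prod C I S) (T_obj C (Prod C I F))"
    unfolding defs by (rule P_map_hom[OF m(1,3) v'])
  note po = hom_obj[OF PD(1)] hom_obj[OF PD(2)]
  note tF = T_proj_hom[OF po(2)] and tF' = T_proj_hom[OF po(4)]
  have "T_arr C ps \<cdot> Pw = Pv \<cdot> pt"
  proof (rule T_ext[OF po(2)])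
    show 1: "T_arr C ps \<cdot> Pw \<in> hom C (Prod C J S') (T_obj C (Prod C I F))"
      by (rule cmp_hom[OF Pw T_arr_hom[OF ps]])
    show 2: "Pv \<cdot> pt \<in> hom C (Prod C J S') (T_obj C (Prod C I F))"
      by (rule cmp_hom[OF pt Pv])
    fix b
    show "T_proj C (Prod C I F) b \<cdot> (T_arr C ps \<cdot> Pw) = T_proj C (Prod C I F) b \<cdot> (Pv \<cdot> pt)"
    proof (rule product_ext[OF Prod_product[OF fin(1) o(1)]])
      show "T_proj C (Prod C I F) b \<cdot> (T_arr C ps \<cdot> Pw) \<in> hom C (Prod C J S') (Prod C I F)"
        by (rule cmp_hom[OF 1 tF])
      show "T_proj C (Prod C I F) b \<cdot> (Pv \<cdot> pt) \<in> hom C (Prod C J S') (Prod C I F)"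
        by (rule cmp_hom[OF 2 tF])
      fix x assume x: "x \<in> I"
      then have xM: "x \<in> nodes M" and y: "\<phi> x \<in> J" and yN: "\<phi> x \<in> nodes N"
        using \<phi> by (auto simp: I_def J_def)
      have pF: "Proj C I F x \<in> hom C (Prod C I F) (F x)"
        and pS: "Proj C I S x \<in> hom C (Prod C I S) (S x)"
        using Proj_hom[OF fin(1)] o x by blast+
      have pF': "Proj C J F' (\<phi> x) \<in> hom C (Prod C J F') (F' (\<phi> x))"
        and pS': "Proj C J S' (\<phi> x) \<in> hom C (Prod C J S') (S' (\<phi> x))"
        using Proj_hom[OF fin(2)] o' y by blast+
      have \<Phi>t: "tot (\<Phi> x) \<in> hom C (S' (\<phi> x)) (S x)"
        and \<Phi>s: "st (\<Phi> x) \<in> hom C (F' (\<phi> x)) (F x)"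
        using hom_surj_arrowsD(5,6)[OF bspec[OF \<Phi> xM]] by (simp_all add: defs)
      have wy: "w (\<phi> x) \<in> hom C (S' (\<phi> x)) (T_obj C (F' (\<phi> x)))"
        and vx: "v x \<in> hom C (S x) (T_obj C (F x))"
        using bspec[OF w' yN] bspec[OF v' xM] by (simp_all add: defs)
      note tx = T_proj_hom[OF bspec[OF o(1) x], of b] and ty = T_proj_hom[OF bspec[OF o'(1) y], of b]
      \<comment> \<open>Naturality of the projection trades \<open>T_arr C ps\<close> for
        \<open>ps\<close>, whose component at \<open>x\<close> is known.\<close>
      have "Proj C I F x \<cdot> (T_proj C (Prod C I F) b \<cdot> (T_arr C ps \<cdot> Pw)) =
          Proj C I F x \<cdot> (ps \<cdot> (T_proj C (Prod C J F') b \<cdot> Pw))"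
        using cmp_assoc[OF Pw T_arr_hom[OF ps] tF, of b] T_proj_T_arr[OF ps, of b]
          cmp_assoc[OF Pw tF' ps, of b] by simp
      also have "\<dots> = (st (\<Phi> x) \<cdot> Proj C J F' (\<phi> x)) \<cdot> (T_proj C (Prod C J F') b \<cdot> Pw)"
        using cmp_assoc[OF cmp_hom[OF Pw tF'] ps pF, of b] Proj_st_Pi_map[OF M N \<phi> \<Phi> xM]
        by (simp add: defs)
      also have "\<dots> = st (\<Phi> x) \<cdot> (T_proj C (F' (\<phi> x)) b \<cdot> (w (\<phi> x) \<cdot> Proj C J S' (\<phi> x)))"
        using cmp_assoc[OF cmp_hom[OF Pw tF'] pF' \<Phi>s, of b]
          Proj_P_map[OF n(1,3) w' yN, of b] by (simp add: defs)
      \<comment> \<open>Naturality is now used backwards, to restore the \<open>T_arr\<close> under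
        which relatedness along \<open>\<Phi> x\<close> is formulated.\<close>
      also have "\<dots> = T_proj C (F x) b \<cdot> (T_arr C (st (\<Phi> x)) \<cdot> (w (\<phi> x) \<cdot> Proj C J S' (\<phi> x)))"
        using cmp_assoc[OF cmp_hom[OF pS' wy] ty \<Phi>s] T_proj_T_arr[OF \<Phi>s, of b]
          cmp_assoc[OF cmp_hom[OF pS' wy] T_arr_hom[OF \<Phi>s] tx] by simp
      also have "\<dots> = T_proj C (F x) b \<cdot> ((v x \<cdot> tot (\<Phi> x)) \<cdot> Proj C J S' (\<phi> x))"
        using cmp_assoc[OF pS' wy T_arr_hom[OF \<Phi>s]] Gam_relD(3)[OF bspec[OF rel xM]] by simp
      also have "\<dots> = T_proj C (F x) b \<cdot> (v x \<cdot> (Proj C I S x \<cdot> pt))"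
        using cmp_assoc[OF pS' \<Phi>t vx] Proj_tot_Pi_map[OF M N \<phi> \<Phi> xM] by (simp add: defs)
      also have "\<dots> = (T_proj C (F x) b \<cdot> (v x \<cdot> Proj C I S x)) \<cdot> pt"
        using cmp_assoc[OF pt pS vx] cmp_assoc[OF pt cmp_hom[OF pS vx] tx] by simp
      also have "\<dots> = (Proj C I F x \<cdot> (T_proj C (Prod C I F) b \<cdot> Pv)) \<cdot> pt"
        using Proj_P_map[OF m(1,3) v' xM, of b] by (simp add: defs)
      also have "\<dots> = Proj C I F x \<cdot> (T_proj C (Prod C I F) b \<cdot> (Pv \<cdot> pt))"
        using cmp_assoc[OF pt cmp_hom[OF Pv tF] pF, of b] cmp_assoc[OF pt Pv tF, of b] by simp
      finally show "Proj C I F x \<cdot> (T_proj C (Prod C I F) b \<cdot> (T_arr C ps \<cdot> Pw)) =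
          Proj C I F x \<cdot> (T_proj C (Prod C I F) b \<cdot> (Pv \<cdot> pt))" .
    qed
  qed
  then show ?thesis
    by (simp add: defs)
qed

section \<open>Transport of relatedness along interconnections, and the square of relations\<close>

text \<open>After composition with \<open>T_arr C (st i)\<close>, both sides of the desired equation
  become \<open>v \<cdot> (tot i \<cdot> tot f)\<close>: the state part of \<open>sq\<close>
  rewrites the left side, and its total part matches the result with the right side. The isomorphism
  \<open>T_arr C (st i)\<close> is then cancelled.\<close>

lemma Gam_fun_related:
  assumes f: "f \<in> hom (surj_arrows C) b a"
    and i: "i \<in> hom (surj_arrows C) a p" "iso_arrow C (st i)"
    and j: "j \<in> hom (surj_arrows C) b q" "iso_arrow C (st j)"
    and k: "k \<in> hom (surj_arrows C) q p"
    and sq: "i \<cdot>\<^bsub>surj_arrows C\<^esub> f = k \<cdot>\<^bsub>surj_arrows C\<^esub> j"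
    and rel: "(w, v) \<in> Gam_rel C k"
  shows "(Gam_fun C j w, Gam_fun C i v) \<in> Gam_rel C f"
proof -
  note f' = hom_surj_arrowsD[OF f] and i' = hom_surj_arrowsD[OF i(1)]
    and j' = hom_surj_arrowsD[OF j(1)] and k' = hom_surj_arrowsD[OF k]
  have w: "w \<in> Gam C q" and v: "v \<in> Gam C p" and kwv: "T_arr C (st k) \<cdot> w = v \<cdot> tot k"
    using Gam_relD[OF rel] k'(3,4) by simp_all
  have sq_tot: "tot i \<cdot> tot f = tot k \<cdot> tot j" and sq_st: "st i \<cdot> st f = st k \<cdot> st j"
    using arg_cong[OF sq, of tot] arg_cong[OF sq, of st] by simp_all
  note Gw = Gam_fun_props[OF j w] and Gv = Gam_fun_props[OF i v]
  note Gw' = GamD(1)[OF Gw(1)] and Gv' = GamD(1)[OF Gv(1)]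
  note Tf = T_arr_hom[OF f'(6)] and Ti = T_arr_hom[OF i'(6)] and Tj = T_arr_hom[OF j'(6)]
    and Tk = T_arr_hom[OF k'(6)]
  have "T_arr C (st i) \<cdot> (T_arr C (st f) \<cdot> Gam_fun C j w) =
      (T_arr C (st k) \<cdot> T_arr C (st j)) \<cdot> Gam_fun C j w"
    using cmp_assoc[OF Gw' Tf Ti] T_arr_cmp[OF f'(6) i'(6)] T_arr_cmp[OF j'(6) k'(6)] sq_st by simp
  also have "\<dots> = (T_arr C (st k) \<cdot> w) \<cdot> tot j"
    using cmp_assoc[OF Gw' Tj Tk] Gw(2) cmp_assoc[OF j'(5) GamD(1)[OF w] Tk] by simp
  also have "\<dots> = v \<cdot> (tot i \<cdot> tot f)"
    using kwv cmp_assoc[OF j'(5) k'(5) GamD(1)[OF v]] sq_tot by simp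
  also have "\<dots> = T_arr C (st i) \<cdot> (Gam_fun C i v \<cdot> tot f)"
    using cmp_assoc[OF f'(5) i'(5) GamD(1)[OF v]] Gv(2) cmp_assoc[OF f'(5) Gv' Ti] by simp
  finally have "T_arr C (st f) \<cdot> Gam_fun C j w = Gam_fun C i v \<cdot> tot f"
    by (rule iso_cancel_left[OF Ti iso_T_arr[OF i'(6) i(2)] cmp_hom[OF Gw' Tf] cmp_hom[OF f'(5) Gv']])
  then show ?thesis
    using Gw(1) Gv(1) f'(3,4) by (simp add: Gam_rel_def)
qed

end

theorem theorem4p4p7:
  fixes C :: "('o, 'm, 'u, 'i) concrete_category"
    and M N :: "('i, 'm) network"
    and \<phi> :: "'i \<Rightarrow> 'i" and \<Phi> :: "'i \<Rightarrow> 'm arrow_mor" and f :: "'m arrow_mor"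
  assumes "concrete_category_with_products C"
    and "is_network C M" and "is_network C N"
    and "is_network_morphism C M N \<phi> \<Phi> f"
  shows "set_square
           (Gam_prod C N) (Gam_prod C M)
           (Gam C (dom_ob (inter N))) (Gam C (dom_ob (inter M)))
           (Gam_prod_rel C M N \<phi> \<Phi>) (Gam_rel C f)
           (Gam_fun C (inter N) \<circ> P_map C (nodes N) (sys N))
           (Gam_fun C (inter M) \<circ> P_map C (nodes M) (sys M))"
proof -
  interpret concrete_category_with_products C
    by (fact assms(1))
  note M = assms(2) and N = assms(3)
  note m = is_networkD[OF M] and n = is_networkD[OF N]
  have \<phi>: "\<phi> \<in> nodes M \<rightarrow> nodes N"
    and \<Phi>: "\<forall>x\<in>nodes M. \<Phi> x \<in> hom (surj_arrows C) (sys N (\<phi> x)) (sys M x)"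
    and f: "f \<in> hom (surj_arrows C) (dom_ob (inter N)) (dom_ob (inter M))"
    and sq: "inter M \<cdot>\<^bsub>surj_arrows C\<^esub> f = Pi_map C M N \<phi> \<Phi> \<cdot>\<^bsub>surj_arrows C\<^esub> inter N"
    using assms(4) by (auto simp: is_network_morphism_def)
  \<comment> \<open>Like \<open>f\<close> and each \<open>\<Phi> x\<close>, the induced map runs
    from the side of \<open>N\<close> to that of \<open>M\<close>, against \<open>\<phi>\<close>;
    hence \<open>N\<close> labels the left column of the square.\<close>
  note k = Pi_map_hom[OF M N \<phi> \<Phi>]
  have Gam_P: "P_map C (nodes K) (sys K) u \<in> Gam C (prod_arr C (nodes K) (sys K))"
    if "is_network C K" "u \<in> Gam_prod C K" for K u
    using P_map_Gam[OF is_networkD(1,3)[OF that(1)]] that(2) by (auto simp: Gam_prod_def)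
  have rel: "(Gam_fun C (inter N) (P_map C (nodes N) (sys N) w),
      Gam_fun C (inter M) (P_map C (nodes M) (sys M) v)) \<in> Gam_rel C f"
    if wv: "(w, v) \<in> Gam_prod_rel C M N \<phi> \<Phi>" for w v
  proof -
    have w: "w \<in> Gam_prod C N" and v: "v \<in> Gam_prod C M"
      and r: "\<forall>x\<in>nodes M. (w (\<phi> x), v x) \<in> Gam_rel C (\<Phi> x)"
      using wv by (auto simp: Gam_prod_rel_def)
    have "T_arr C (st (Pi_map C M N \<phi> \<Phi>)) \<cdot>\<^bsub>C\<^esub> P_map C (nodes N) (sys N) w =
        P_map C (nodes M) (sys M) v \<cdot>\<^bsub>C\<^esub> tot (Pi_map C M N \<phi> \<Phi>)"
      using w v by (intro P_map_natural[OF M N \<phi> \<Phi> _ _ r]) (auto simp: Gam_prod_def)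
    then have "(P_map C (nodes N) (sys N) w, P_map C (nodes M) (sys M) v)
        \<in> Gam_rel C (Pi_map C M N \<phi> \<Phi>)"
      using Gam_P[OF N w] Gam_P[OF M v] hom_surj_arrowsD(3,4)[OF k] by (simp add: Gam_rel_def)
    \<comment> \<open>The hypothesis \<open>sq\<close> of the network morphism is exactly the
      commuting square over which relatedness along \<open>Pi_map\<close> is pulled back to
      \<open>f\<close>.\<close>
    then show ?thesis
      by (rule Gam_fun_related[OF f m(4,5) n(4,5) k sq])
  qed
  have "Gam_rel C f \<subseteq> Gam C (dom_ob (inter N)) \<times> Gam C (dom_ob (inter M))"
    using hom_surj_arrowsD(3,4)[OF f] by (auto simp: Gam_rel_def)
  moreover have "Gam_prod_rel C M N \<phi> \<Phi> \<subseteq> Gam_prod C N \<times> Gam_prod C M"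
    by (auto simp: Gam_prod_rel_def)
  ultimately show ?thesis
    using rel Gam_fun_Gam[OF n(4,5) Gam_P[OF N]] Gam_fun_Gam[OF m(4,5) Gam_P[OF M]]
    by (auto simp: set_square_def)
qed

end
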